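(* Let $u_{\mathrm{ms}}^\ell=M_h^\ell(u_H^\ell)$ be the patch-solved localized solution, and assume that $u_H^\ell\in V_H$ solves the localized tangent-space coarse problem exactly, $$\operatorname{Res}(u_{\mathrm{ms}}^\ell)\bigl(DM_h^\ell(u_H^\ell)[\xi_H]\bigr)=0\qquad\forall\,\xi_H\in V_H .$$ Assume that there are $m_A,L_A>0$ with $$m_A\|v_h-w_h\|_V^2\le A(v_h;v_h-w_h)-A(w_h;v_h-w_h),\qquad \|A(v_h;\cdot)-A(w_h;\cdot)\|_{V_h'}\le L_A\|v_h-w_h\|_V\qquad\forall\,v_h,w_h\in\mathcal U_h,$$ and that $$\bigl\|\bigl(DM_h^\ell(v_H)-DM_h^\ell(w_H)\bigr)[\xi_H]\bigr\|_V\le L_{\widetilde M,1}^\ell\|v_H-w_H\|_V\|\xi_H\|_V\qquad\forall\,v_H,w_H\in\mathcal U_H,\ \forall\,\xi_H\in V_H .$$ Let $\gamma_{\mathrm{ch}}^\ell=\tfrac12L_AL_{\widetilde M,1}^\ell C_\Pi^2$ and $$\eta_{\mathrm{loc}}(H,\ell)=\sup_{v_H\in\mathcal U_H}\|M_h(v_H)-M_h^\ell(v_H)\|_V .$$ Then $$\|u_h-u_{\mathrm{ms}}^\ell\|_V\le\frac{2L_A}{m_A}\,\eta_{\mathrm{loc}}(H,\ell),$$ provided $\gamma_{\mathrm{ch}}^\ell\|u_h-u_{\mathrm{ms}}^\ell\|_V\le\tfrac12m_A$.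
   Context: Basic setting. Let $\Omega$ be a bounded polygonal or polyhedral domain with nested, shape-regular, quasi-uniform triangulations $\mathcal T_H$ (coarse) and $\mathcal T_h$ (fine, a refinement of $\mathcal T_H$); $V_H\subset V_h$ are the corresponding (finite-dimensional) spaces of continuous piecewise linear finite element functions with homogeneous Dirichlet boundary conditions, and $\|\cdot\|_V$ is the energy norm on $V_h$. $A(\cdot;\cdot):V_h\times V_h\to\mathbb R$ is nonlinear in its first and linear in its second argument; $L:V_h\to\mathbb R$ is linear. $u_h\in V_h$ is the (unique) solution of $A(u_h;v_h)=L(v_h)$ for all $v_h\in V_h$. $\Pi_H:V_h\to V_H$ is a linear projection onto $V_H$ ($\Pi_Hv_H=v_H$ for $v_H\in V_H$) with $\|\Pi_Hv_h\|_V\le C_\Pi\|v_h\|_V$ for all $v_h\in V_h$; $V_f=\ker\Pi_H$. Dual norms are $\|F\|_{V_h'}=\sup_{0\ne v_h\in V_h}|F(v_h)|/\|v_h\|_V$. The residual is $\operatorname{Res}(z_h)(w_h)=L(w_h)-A(z_h;w_h)$ for $z_h,w_h\in V_h$. Ideal reconstruction. For $v_H\in V_H$, $v_f(v_H)\in V_f$ is the (assumed unique) solution of $A(v_H+v_f(v_H);w_f)=L(w_f)$ for all $w_f\in V_f$, and $M_h(v_H)=v_H+v_f(v_H)$; one has $u_h=M_h(\Pi_Hu_h)$. Patch-solved localized reconstruction. $\{\varphi_{H,i}\}_{i\in\mathcal I}$ is a partition of unity subordinate to $\mathcal T_H$, each support being a union of coarse elements; $\omega_i^0=\operatorname{int}(\operatorname{supp}\varphi_{H,i})$,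 and $\omega_i^\ell$ is obtained from $\omega_i^0$ by adding $\ell\ge0$ times all coarse elements whose closure meets the closure of the current set. With a basis $\{\Phi_j\}$ of $V_H$, $P_iv_H\in\mathbb R^{n_{H,i}}$ is the vector of those coefficients of $v_H$ whose basis functions have support meeting $\omega_i^\ell$. $V_{f,i}^\ell=\{v_f\in V_f:\operatorname{supp}v_f\subset\overline{\omega_i^\ell},\ v_f=0\text{ on }\partial\omega_i^\ell\}$; $R_i$ is restriction to $\omega_i^0$, $E_{i,0}^{\mathrm{ext}}$ is extension by zero from $\omega_i^0$, and $I_h$ is a stable linear fine-grid interpolation or projection into $V_h$. The local correction $v_{f,i}^\ell(P_iv_H)\in V_{f,i}^\ell$ is the (assumed unique) solution of $A_{\omega_i^\ell}(v_H+v_{f,i}^\ell(P_iv_H);w)=L_{\omega_i^\ell}(w)$ for all $w\in V_{f,i}^\ell$, where $A_{\omega_i^\ell},L_{\omega_i^\ell}$ are the restrictions of $A,L$ to the patch. Then $$M_h^\ell(v_H)=v_H+(I-\Pi_H)I_h\Bigl(\sum_{i\in\mathcal I}\varphi_{H,i}E_{i,0}^{\mathrm{ext}}R_iv_{f,i}^\ell(P_iv_H)\Bigr),$$ and in particular $\Pi_HM_h^\ell(v_H)=v_H$. Standing assumptions. $\mathcal U_h\subset V_h$ and $\mathcal U_H\subset V_H$ are admissible sets; $M_h^\ell$ is differentiable on $\mathcal U_H$; the segment $u_H^\ell+s(\Pi_Hu_h-u_H^\ell)$, $0\le s\le1$, lies in $\mathcal U_H$; and $u_h$, $u_{\mathrm{ms}}^\ell$,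 $M_h^\ell(\Pi_Hu_h)$ lie in $\mathcal U_h$. *)

theory Defs
  imports "HOL-Analysis.Analysis" "HOL-Library.Function_Algebras"
begin

text \<open>
  Finite element functions are real functions on the whole space that vanish outside the domain
  (extension by zero). Sums, differences and products of functions are pointwise.
\<close>

section \<open>Spaces of functions\<close>

definition fscale :: "real \<Rightarrow> ('a \<Rightarrow> real) \<Rightarrow> 'a \<Rightarrow> real" where
  "fscale c u = (\<lambda>x. c * u x)"

definition fsubspace :: "('a \<Rightarrow> real) set \<Rightarrow> bool" where
  "fsubspace V \<longleftrightarrow> 0 \<in> V \<and> (\<forall>u\<in>V. \<forall>v\<in>V. u + v \<in> V) \<and> (\<forall>c. \<forall>u\<in>V. fscale c u \<in> V)"

definition linear_functional_on :: "('a \<Rightarrow> real) set \<Rightarrow> (('a \<Rightarrow> real) \<Rightarrow> real) \<Rightarrow> bool" where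
  "linear_functional_on V F \<longleftrightarrow>
     (\<forall>u\<in>V. \<forall>v\<in>V. F (u + v) = F u + F v) \<and> (\<forall>c. \<forall>u\<in>V. F (fscale c u) = c * F u)"

definition linear_map_on ::
  "('a \<Rightarrow> real) set \<Rightarrow> ('a \<Rightarrow> real) set \<Rightarrow> (('a \<Rightarrow> real) \<Rightarrow> 'a \<Rightarrow> real) \<Rightarrow> bool" where
  "linear_map_on V W T \<longleftrightarrow>
     T ` V \<subseteq> W \<and>
     (\<forall>u\<in>V. \<forall>v\<in>V. T (u + v) = T u + T v) \<and> (\<forall>c. \<forall>u\<in>V. T (fscale c u) = fscale c (T u))"

definition linear_projection_on ::
  "('a \<Rightarrow> real) set \<Rightarrow> ('a \<Rightarrow> real) set \<Rightarrow> (('a \<Rightarrow> real) \<Rightarrow> 'a \<Rightarrow> real) \<Rightarrow> bool" where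
  "linear_projection_on V W T \<longleftrightarrow> linear_map_on V W T \<and> (\<forall>w\<in>W. T w = w)"

definition basis_of :: "('a \<Rightarrow> real) set \<Rightarrow> 'j set \<Rightarrow> ('j \<Rightarrow> 'a \<Rightarrow> real) \<Rightarrow> bool" where
  "basis_of V J \<Phi> \<longleftrightarrow>
     finite J \<and> \<Phi> ` J \<subseteq> V \<and>
     (\<forall>v\<in>V. \<exists>c. v = (\<lambda>x. \<Sum>j\<in>J. c j * \<Phi> j x)) \<and>
     (\<forall>c. (\<lambda>x. \<Sum>j\<in>J. c j * \<Phi> j x) = 0 \<longrightarrow> (\<forall>j\<in>J. c j = 0))"

definition coefficients :: "'j set \<Rightarrow> ('j \<Rightarrow> 'a \<Rightarrow> real) \<Rightarrow> ('a \<Rightarrow> real) \<Rightarrow> 'j \<Rightarrow> real" where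
  "coefficients J \<Phi> v = (THE c. c \<in> extensional J \<and> v = (\<lambda>x. \<Sum>j\<in>J. c j * \<Phi> j x))"

text \<open>
  The energy norm is induced by a symmetric positive definite energy form on the fine space V.
  The form is also given on a larger space X, where it may be only semidefinite.
\<close>

definition energy_form ::
  "('a \<Rightarrow> real) set \<Rightarrow> ('a \<Rightarrow> real) set \<Rightarrow> (('a \<Rightarrow> real) \<Rightarrow> ('a \<Rightarrow> real) \<Rightarrow> real) \<Rightarrow> bool" where
  "energy_form X V a \<longleftrightarrow>
     (\<forall>u\<in>X. linear_functional_on X (a u)) \<and>
     (\<forall>u\<in>X. \<forall>v\<in>X. a u v = a v u) \<and>
     (\<forall>u\<in>X. 0 \<le> a u u) \<and>
     (\<forall>v\<in>V. v \<noteq> 0 \<longrightarrow> 0 < a v v)"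

definition energy_norm ::
  "(('a \<Rightarrow> real) \<Rightarrow> ('a \<Rightarrow> real) \<Rightarrow> real) \<Rightarrow> ('a \<Rightarrow> real) \<Rightarrow> real" where
  "energy_norm a v = sqrt (a v v)"

definition dual_norm ::
  "('a \<Rightarrow> real) set \<Rightarrow> (('a \<Rightarrow> real) \<Rightarrow> real) \<Rightarrow> (('a \<Rightarrow> real) \<Rightarrow> real) \<Rightarrow> ennreal" where
  "dual_norm V nrm F = (SUP v\<in>V - {0}. ennreal (\<bar>F v\<bar> / nrm v))"

text \<open>
  D is the Frechet derivative at v of M, a map from V to W. Both spaces carry the norm nrm.
\<close>

definition has_frechet_derivative ::
  "('a \<Rightarrow> real) set \<Rightarrow> ('a \<Rightarrow> real) set \<Rightarrow> (('a \<Rightarrow> real) \<Rightarrow> real) \<Rightarrow>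
   (('a \<Rightarrow> real) \<Rightarrow> 'a \<Rightarrow> real) \<Rightarrow> (('a \<Rightarrow> real) \<Rightarrow> 'a \<Rightarrow> real) \<Rightarrow> ('a \<Rightarrow> real) \<Rightarrow> bool" where
  "has_frechet_derivative V W nrm M D v \<longleftrightarrow>
     linear_map_on V W D \<and>
     (\<forall>\<epsilon>>0. \<exists>\<delta>>0. \<forall>\<xi>\<in>V. nrm \<xi> < \<delta> \<longrightarrow> nrm (M (v + \<xi>) - M v - D \<xi>) \<le> \<epsilon> * nrm \<xi>)"


section \<open>Meshes and piecewise linear finite elements\<close>

definition polyhedral_domain :: "'a::euclidean_space set \<Rightarrow> bool" where
  "polyhedral_domain \<Omega> \<longleftrightarrow>
     \<Omega> \<noteq> {} \<and> connected \<Omega> \<and>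
     (\<exists>\<P>. finite \<P> \<and> (\<forall>P\<in>\<P>. polytope P) \<and> \<Omega> = interior (\<Union>\<P>))"

definition mesh_of :: "'a::euclidean_space set \<Rightarrow> 'a set set \<Rightarrow> bool" where
  "mesh_of \<Omega> \<T> \<longleftrightarrow>
     triangulation \<T> \<and> (\<forall>K\<in>\<T>. int DIM('a) simplex K) \<and> \<Union>\<T> = closure \<Omega>"

definition mesh_refinement :: "'a set set \<Rightarrow> 'a set set \<Rightarrow> bool" where
  "mesh_refinement \<S> \<T> \<longleftrightarrow> (\<forall>k\<in>\<S>. \<exists>K\<in>\<T>. k \<subseteq> K)"

definition inradius :: "'a::euclidean_space set \<Rightarrow> real" where
  "inradius K = Sup {r. 0 \<le> r \<and> (\<exists>x. cball x r \<subseteq> K)}"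

definition mesh_size :: "'a::euclidean_space set set \<Rightarrow> real" where
  "mesh_size \<T> = Max (diameter ` \<T>)"

definition shape_regular :: "real \<Rightarrow> 'a::euclidean_space set set \<Rightarrow> bool" where
  "shape_regular \<rho> \<T> \<longleftrightarrow> (\<forall>K\<in>\<T>. diameter K \<le> \<rho> * inradius K)"

definition quasi_uniform :: "real \<Rightarrow> 'a::euclidean_space set set \<Rightarrow> bool" where
  "quasi_uniform \<tau> \<T> \<longleftrightarrow> (\<forall>K\<in>\<T>. mesh_size \<T> \<le> \<tau> * diameter K)"

text \<open>Vanishing off the open set \<open>\<Omega>\<close> includes the homogeneous Dirichlet condition.\<close>

definition p1_space :: "'a::euclidean_space set \<Rightarrow> 'a set set \<Rightarrow> ('a \<Rightarrow> real) set" where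
  "p1_space \<Omega> \<T> =
     {v. continuous_on (closure \<Omega>) v \<and>
         (\<forall>K\<in>\<T>. \<exists>g c. \<forall>x\<in>K. v x = g \<bullet> x + c) \<and>
         (\<forall>x. x \<notin> \<Omega> \<longrightarrow> v x = 0)}"

definition supp :: "('a::topological_space \<Rightarrow> real) \<Rightarrow> 'a set" where
  "supp f = closure {x. f x \<noteq> 0}"

text \<open>The functions \<open>\<phi> i\<close> live on \<open>closure \<Omega>\<close> and are extended by zero; they need not vanish on
  the boundary.\<close>

definition partition_of_unity_on ::
  "'a::euclidean_space set \<Rightarrow> 'a set set \<Rightarrow> 'i set \<Rightarrow> ('i \<Rightarrow> 'a \<Rightarrow> real) \<Rightarrow> bool" where
  "partition_of_unity_on \<Omega> \<T> I \<phi> \<longleftrightarrow>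
     finite I \<and>
     (\<forall>i\<in>I. continuous_on (closure \<Omega>) (\<phi> i) \<and> (\<forall>x. 0 \<le> \<phi> i x) \<and>
            (\<exists>\<S>\<subseteq>\<T>. supp (\<phi> i) = \<Union>\<S>)) \<and>
     (\<forall>x\<in>closure \<Omega>. (\<Sum>i\<in>I. \<phi> i x) = 1)"

text \<open>The open patch obtained from S by adding l layers of (closed) elements.\<close>

primrec patch :: "'a::euclidean_space set set \<Rightarrow> nat \<Rightarrow> 'a set \<Rightarrow> 'a set" where
  "patch \<T> 0 S = S"
| "patch \<T> (Suc l) S =
     interior (closure (patch \<T> l S) \<union> \<Union>{K\<in>\<T>. K \<inter> closure (patch \<T> l S) \<noteq> {}})"


section \<open>Ideal reconstruction\<close>

definition residual ::
  "(('a \<Rightarrow> real) \<Rightarrow> ('a \<Rightarrow> real) \<Rightarrow> real) \<Rightarrow> (('a \<Rightarrow> real) \<Rightarrow> real) \<Rightarrow>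
   ('a \<Rightarrow> real) \<Rightarrow> ('a \<Rightarrow> real) \<Rightarrow> real" where
  "residual A L z w = L w - A z w"

definition kernel_in ::
  "('a \<Rightarrow> real) set \<Rightarrow> (('a \<Rightarrow> real) \<Rightarrow> 'a \<Rightarrow> real) \<Rightarrow> ('a \<Rightarrow> real) set" where
  "kernel_in V PH = {v\<in>V. PH v = 0}"

text \<open>\<open>v\<close> is the correction in the space W of the coarse function \<open>vH\<close>.\<close>

definition solves_correction ::
  "('a \<Rightarrow> real) set \<Rightarrow> (('a \<Rightarrow> real) \<Rightarrow> ('a \<Rightarrow> real) \<Rightarrow> real) \<Rightarrow> (('a \<Rightarrow> real) \<Rightarrow> real) \<Rightarrow>
   ('a \<Rightarrow> real) \<Rightarrow> ('a \<Rightarrow> real) \<Rightarrow> bool" where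
  "solves_correction W A L vH v \<longleftrightarrow> v \<in> W \<and> (\<forall>w\<in>W. A (vH + v) w = L w)"

definition ideal_reconstruction ::
  "('a \<Rightarrow> real) set \<Rightarrow> (('a \<Rightarrow> real) \<Rightarrow> ('a \<Rightarrow> real) \<Rightarrow> real) \<Rightarrow> (('a \<Rightarrow> real) \<Rightarrow> real) \<Rightarrow>
   ('a \<Rightarrow> real) \<Rightarrow> 'a \<Rightarrow> real" where
  "ideal_reconstruction Vf A L vH = vH + (THE v. solves_correction Vf A L vH v)"


section \<open>Patch-solved localized reconstruction\<close>

definition restriction :: "'a set \<Rightarrow> ('a \<Rightarrow> real) \<Rightarrow> 'a \<Rightarrow> real" where
  "restriction \<omega> v = restrict v \<omega>"

definition zero_extension :: "'a set \<Rightarrow> ('a \<Rightarrow> real) \<Rightarrow> 'a \<Rightarrow> real" where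
  "zero_extension \<omega> v = (\<lambda>x. if x \<in> \<omega> then v x else 0)"

definition patch_space :: "('a::topological_space \<Rightarrow> real) set \<Rightarrow> 'a set \<Rightarrow> ('a \<Rightarrow> real) set" where
  "patch_space V \<omega> = {v\<in>V. supp v \<subseteq> closure \<omega> \<and> (\<forall>x\<in>frontier \<omega>. v x = 0)}"

text \<open>
  A form restricted to a patch (for integral forms: the integral over the patch only) sees its
  arguments only through their values in the patch, and it agrees with the global form when the
  test function is supported in the patch.
\<close>

definition patch_restriction_form ::
  "('a::topological_space \<Rightarrow> real) set \<Rightarrow> 'a set \<Rightarrow>
   (('a \<Rightarrow> real) \<Rightarrow> ('a \<Rightarrow> real) \<Rightarrow> real) \<Rightarrow> (('a \<Rightarrow> real) \<Rightarrow> ('a \<Rightarrow> real) \<Rightarrow> real) \<Rightarrow> bool" where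
  "patch_restriction_form V \<omega> A A\<omega> \<longleftrightarrow>
     (\<forall>v\<in>V. \<forall>v'\<in>V. \<forall>w\<in>V. \<forall>w'\<in>V.
        (\<forall>x\<in>\<omega>. v x = v' x) \<longrightarrow> (\<forall>x\<in>\<omega>. w x = w' x) \<longrightarrow> A\<omega> v w = A\<omega> v' w') \<and>
     (\<forall>v\<in>V. \<forall>w\<in>patch_space V \<omega>. A\<omega> v w = A v w)"

definition patch_restriction_functional ::
  "('a::topological_space \<Rightarrow> real) set \<Rightarrow> 'a set \<Rightarrow>
   (('a \<Rightarrow> real) \<Rightarrow> real) \<Rightarrow> (('a \<Rightarrow> real) \<Rightarrow> real) \<Rightarrow> bool" where
  "patch_restriction_functional V \<omega> L L\<omega> \<longleftrightarrow>
     (\<forall>w\<in>V. \<forall>w'\<in>V. (\<forall>x\<in>\<omega>. w x = w' x) \<longrightarrow> L\<omega> w = L\<omega> w') \<and>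
     (\<forall>w\<in>patch_space V \<omega>. L\<omega> w = L w)"

definition patch_coefficients ::
  "'j set \<Rightarrow> ('j \<Rightarrow> 'a::topological_space \<Rightarrow> real) \<Rightarrow> 'a set \<Rightarrow> ('a \<Rightarrow> real) \<Rightarrow> 'j \<Rightarrow> real" where
  "patch_coefficients J \<Phi> \<omega> v = restrict (coefficients J \<Phi> v) {j\<in>J. supp (\<Phi> j) \<inter> \<omega> \<noteq> {}}"

text \<open>
  The correction as a function of the patch coefficient vector p: two coarse functions with the
  same patch coefficients agree on the patch, so they have the same local correction.
\<close>

definition local_correction ::
  "('a::topological_space \<Rightarrow> real) set \<Rightarrow> ('a \<Rightarrow> real) set \<Rightarrow> 'j set \<Rightarrow> ('j \<Rightarrow> 'a \<Rightarrow> real) \<Rightarrow>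
   ('a set \<Rightarrow> ('a \<Rightarrow> real) \<Rightarrow> ('a \<Rightarrow> real) \<Rightarrow> real) \<Rightarrow> ('a set \<Rightarrow> ('a \<Rightarrow> real) \<Rightarrow> real) \<Rightarrow>
   'a set \<Rightarrow> ('j \<Rightarrow> real) \<Rightarrow> 'a \<Rightarrow> real" where
  "local_correction VH Vf J \<Phi> Aloc Lloc \<omega> p =
     (THE v. \<forall>vH\<in>VH. patch_coefficients J \<Phi> \<omega> vH = p \<longrightarrow>
               solves_correction (patch_space Vf \<omega>) (Aloc \<omega>) (Lloc \<omega>) vH v)"

definition localized_reconstruction ::
  "'a::euclidean_space set set \<Rightarrow> ('a \<Rightarrow> real) set \<Rightarrow> ('a \<Rightarrow> real) set \<Rightarrow>
   (('a \<Rightarrow> real) \<Rightarrow> 'a \<Rightarrow> real) \<Rightarrow> (('a \<Rightarrow> real) \<Rightarrow> 'a \<Rightarrow> real) \<Rightarrow>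
   'j set \<Rightarrow> ('j \<Rightarrow> 'a \<Rightarrow> real) \<Rightarrow> 'i set \<Rightarrow> ('i \<Rightarrow> 'a \<Rightarrow> real) \<Rightarrow>
   ('a set \<Rightarrow> ('a \<Rightarrow> real) \<Rightarrow> ('a \<Rightarrow> real) \<Rightarrow> real) \<Rightarrow> ('a set \<Rightarrow> ('a \<Rightarrow> real) \<Rightarrow> real) \<Rightarrow>
   nat \<Rightarrow> ('a \<Rightarrow> real) \<Rightarrow> 'a \<Rightarrow> real" where
  "localized_reconstruction TH VH Vf PH Ih J \<Phi> I \<phi> Aloc Lloc l vH =
     (let \<omega>0 = (\<lambda>i. interior (supp (\<phi> i)));
          \<omega> = (\<lambda>i. patch TH l (\<omega>0 i));
          z = Ih (\<Sum>i\<in>I. \<phi> i * zero_extension (\<omega>0 i) (restriction (\<omega>0 i)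
                (local_correction VH Vf J \<Phi> Aloc Lloc (\<omega> i)
                  (patch_coefficients J \<Phi> (\<omega> i) vH))))
      in vH + (z - PH z))"

text \<open>The supremum is extended, so it may be infinite.\<close>

definition localization_error ::
  "(('a \<Rightarrow> real) \<Rightarrow> real) \<Rightarrow> ('a \<Rightarrow> real) set \<Rightarrow>
   (('a \<Rightarrow> real) \<Rightarrow> 'a \<Rightarrow> real) \<Rightarrow> (('a \<Rightarrow> real) \<Rightarrow> 'a \<Rightarrow> real) \<Rightarrow> ennreal" where
  "localization_error nrm UH M Ml = (SUP v\<in>UH. ennreal (nrm (M v - Ml v)))"

end

theory Submission
  imports Defs
begin

text \<open>
  Put \<open>e = uh - ums\<close> and \<open>\<xi> = PH uh - uH = PH e\<close>. Strong monotonicity bounds \<open>mA * (nrm e)^2\<close> by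
  the residual of \<open>ums\<close> at \<open>e = (uh - Ml (PH uh)) + (Ml (PH uh) - Ml uH)\<close>. The first part is at most
  \<open>LA * nrm e * \<eta>\<close>, because \<open>uh = M (PH uh)\<close>. For the second part the first-order term
  \<open>DMl uH \<xi>\<close> is annihilated by the residual, and the Taylor remainder is at most
  \<open>LM / 2 * (nrm \<xi>)^2\<close>, so this part contributes at most \<open>\<gamma> * (nrm e)^3\<close>, which the smallness
  condition absorbs into half of the left-hand side. The Taylor estimate is applied to the real
  function obtained by composing \<open>Ml\<close> along the segment with the residual functional.
\<close>

section \<open>Linear algebra of function spaces\<close>

lemma linear_functional_on_add:
  "linear_functional_on V F \<Longrightarrow> u \<in> V \<Longrightarrow> v \<in> V \<Longrightarrow> F (u + v) = F u + F v"
  by (simp add: linear_functional_on_def)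

lemma linear_functional_on_scale:
  "linear_functional_on V F \<Longrightarrow> u \<in> V \<Longrightarrow> F (fscale c u) = c * F u"
  by (simp add: linear_functional_on_def)

lemma fscale_minus_one: "u + fscale (-1) v = u - v"
  by (simp add: fscale_def fun_eq_iff)

lemma linear_functional_on_diff:
  assumes "fsubspace V" "linear_functional_on V F" "u \<in> V" "v \<in> V"
  shows "F (u - v) = F u - F v"
proof -
  have "fscale (-1) v \<in> V" using assms by (simp add: fsubspace_def)
  then show ?thesis
    using linear_functional_on_add[OF assms(2,3), of "fscale (-1) v"]
      linear_functional_on_scale[OF assms(2,4), of "-1"]
    by (simp add: fscale_minus_one)
qed

lemma fsubspace_add: "fsubspace V \<Longrightarrow> u \<in> V \<Longrightarrow> v \<in> V \<Longrightarrow> u + v \<in> V"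
  by (simp add: fsubspace_def)

lemma fsubspace_scale: "fsubspace V \<Longrightarrow> u \<in> V \<Longrightarrow> fscale c u \<in> V"
  by (simp add: fsubspace_def)

lemma fsubspace_diff: "fsubspace V \<Longrightarrow> u \<in> V \<Longrightarrow> v \<in> V \<Longrightarrow> u - v \<in> V"
  using fsubspace_add fsubspace_scale fscale_minus_one by metis

lemma fsubspace_sum:
  assumes "fsubspace V" "\<And>i. i \<in> I \<Longrightarrow> f i \<in> V"
  shows "sum f I \<in> V"
  using assms(2)
  by (induction I rule: infinite_finite_induct)
    (use assms(1) in \<open>auto simp: fsubspace_def\<close>)

lemma linear_map_on_diff:
  assumes "fsubspace V" "linear_map_on V W T" "u \<in> V" "v \<in> V"
  shows "T (u - v) = T u - T v"
proof -
  have "fscale (-1) v \<in> V" using assms by (simp add: fsubspace_def)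
  then have "T (u + fscale (-1) v) = T u + fscale (-1) (T v)"
    using assms by (simp add: linear_map_on_def)
  then show ?thesis by (simp only: fscale_minus_one)
qed

section \<open>Energy norm and dual norm\<close>

lemma energy_norm_nonneg: "0 \<le> a v v \<Longrightarrow> 0 \<le> energy_norm a v"
  by (simp add: energy_norm_def)

lemma energy_norm_fscale:
  assumes "fsubspace X" "energy_form X V a" "u \<in> X"
  shows "energy_norm a (fscale c u) = \<bar>c\<bar> * energy_norm a u"
proof -
  have c: "fscale c u \<in> X" using assms fsubspace_scale by blast
  have lin: "linear_functional_on X (a w)" if "w \<in> X" for w
    using assms(2) that by (simp add: energy_form_def)
  have sym: "a (fscale c u) u = a u (fscale c u)"
    using assms(2,3) c by (simp add: energy_form_def)
  have "a (fscale c u) (fscale c u) = c * (c * a u u)"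
    using linear_functional_on_scale[OF lin[OF c] assms(3)] sym
      linear_functional_on_scale[OF lin[OF assms(3)] assms(3)] by simp
  then show ?thesis
    by (simp add: energy_norm_def real_sqrt_mult flip: mult.assoc)
qed

text \<open>Each quotient \<open>\<bar>F v\<bar> / nrm v\<close> is one of the terms of the
  supremum. The zero function is excluded there and is treated separately.\<close>

lemma abs_le_of_dual_norm_le:
  assumes "fsubspace V" "linear_functional_on V F"
    and "\<And>v. v \<in> V \<Longrightarrow> v \<noteq> 0 \<Longrightarrow> 0 < nrm v" and "0 \<le> nrm 0"
    and "dual_norm V nrm F \<le> ennreal C" and "0 \<le> C" and "v \<in> V"
  shows "\<bar>F v\<bar> \<le> C * nrm v"
proof (cases "v = 0")
  case True
  \<comment> \<open>Additivity at \<open>0 + 0\<close> forces \<open>F 0 = 0\<close>.\<close>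
  have "0 \<in> V" using assms(1) by (simp add: fsubspace_def)
  then have "F (0 + 0) = F 0 + F 0" by (rule linear_functional_on_add[OF assms(2)]) fact
  then show ?thesis using True assms(4,6) by simp
next
  case False
  have "ennreal (\<bar>F v\<bar> / nrm v) \<le> dual_norm V nrm F"
    unfolding dual_norm_def using False assms(7) by (intro SUP_upper) auto
  also note assms(5)
  finally have "\<bar>F v\<bar> / nrm v \<le> C"
    using assms(6) by (simp add: ennreal_le_iff)
  then show ?thesis using assms(3)[OF assms(7) False] by (simp add: divide_simps)
qed

section \<open>Piecewise linear finite element spaces\<close>

lemma p1_space_iff:
  "v \<in> p1_space \<Omega> \<T> \<longleftrightarrow> continuous_on (closure \<Omega>) v \<and>
     (\<forall>K\<in>\<T>. \<exists>g c. \<forall>x\<in>K. v x = g \<bullet> x + c) \<and> (\<forall>x. x \<notin> \<Omega> \<longrightarrow> v x = 0)"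
  unfolding p1_space_def by (rule mem_Collect_eq)

lemma fsubspace_p1_space: "fsubspace (p1_space \<Omega> \<T>)"
  unfolding fsubspace_def
proof (intro conjI ballI allI)
  show "0 \<in> p1_space \<Omega> \<T>"
    unfolding p1_space_iff
  proof (intro conjI ballI allI impI)
    show "continuous_on (closure \<Omega>) (0 :: 'a \<Rightarrow> real)"
      unfolding zero_fun_def by (rule continuous_on_const)
    show "\<exists>g c. \<forall>x\<in>K. (0 :: 'a \<Rightarrow> real) x = g \<bullet> x + c" for K
      by (rule exI[of _ 0], rule exI[of _ 0]) simp
  qed simp
next
  fix u v assume uv: "u \<in> p1_space \<Omega> \<T>" "v \<in> p1_space \<Omega> \<T>"
  show "u + v \<in> p1_space \<Omega> \<T>"
    unfolding p1_space_iff
  proof (intro conjI ballI allI impI)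
    show "continuous_on (closure \<Omega>) (u + v)"
      unfolding func_plus using uv p1_space_iff by (metis continuous_on_add)
    show "\<exists>g c. \<forall>x\<in>K. (u + v) x = g \<bullet> x + c" if K: "K \<in> \<T>" for K
    proof -
      obtain g c where u: "\<forall>x\<in>K. u x = g \<bullet> x + c"
        using uv(1) K unfolding p1_space_iff by metis
      obtain g' c' where v: "\<forall>x\<in>K. v x = g' \<bullet> x + c'"
        using uv(2) K unfolding p1_space_iff by metis
      have "(u + v) x = (g + g') \<bullet> x + (c + c')" if "x \<in> K" for x
        using u v that by (simp add: inner_add_left)
      then show ?thesis by blast
    qed
    show "(u + v) x = 0" if "x \<notin> \<Omega>" for x
      using uv that unfolding p1_space_iff by simp
  qed
next
  fix b :: real and u assume u: "u \<in> p1_space \<Omega> \<T>"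
  show "fscale b u \<in> p1_space \<Omega> \<T>"
    unfolding p1_space_iff
  proof (intro conjI ballI allI impI)
    show "continuous_on (closure \<Omega>) (fscale b u)"
      unfolding fscale_def using u p1_space_iff by (metis continuous_on_mult_left)
    show "\<exists>g c. \<forall>x\<in>K. fscale b u x = g \<bullet> x + c" if K: "K \<in> \<T>" for K
    proof -
      obtain g c where u: "\<forall>x\<in>K. u x = g \<bullet> x + c"
        using u K unfolding p1_space_iff by metis
      have "fscale b u x = (b *\<^sub>R g) \<bullet> x + b * c" if "x \<in> K" for x
        using u that by (simp add: fscale_def distrib_left)
      then show ?thesis by blast
    qed
    show "fscale b u x = 0" if "x \<notin> \<Omega>" for x
      using u that unfolding p1_space_iff fscale_def by simp
  qed
qed

text \<open>Each fine element lies in a coarse one, and the affine formula on the coarse element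
  restricts to it. This gives the nesting of \<open>VH\<close> in \<open>Vh\<close>.\<close>

lemma p1_space_mono_refinement:
  assumes "mesh_refinement \<S> \<T>"
  shows "p1_space \<Omega> \<T> \<subseteq> p1_space \<Omega> \<S>"
proof
  fix v assume v: "v \<in> p1_space \<Omega> \<T>"
  have "\<exists>g c. \<forall>x\<in>k. v x = g \<bullet> x + c" if k: "k \<in> \<S>" for k
  proof -
    obtain K where K: "K \<in> \<T>" "k \<subseteq> K" using assms k unfolding mesh_refinement_def by blast
    then obtain g c where "\<forall>x\<in>K. v x = g \<bullet> x + c"
      using v unfolding p1_space_iff by metis
    then show ?thesis using K(2) by (meson subsetD)
  qed
  then show "v \<in> p1_space \<Omega> \<S>" using v unfolding p1_space_iff by simp
qed

section \<open>Basis coefficients and local corrections\<close>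

text \<open>Justifies the definite description in \<open>coefficients\<close>: restricting any
  expansion to \<open>J\<close> gives an extensional representative, and linear independence makes
  it the only one.\<close>

lemma coefficients_expansion:
  assumes "basis_of V J \<Phi>" "v \<in> V"
  shows "v = (\<lambda>x. \<Sum>j\<in>J. coefficients J \<Phi> v j * \<Phi> j x)"
proof -
  let ?Q = "\<lambda>c. c \<in> extensional J \<and> v = (\<lambda>x. \<Sum>j\<in>J. c j * \<Phi> j x)"
  obtain c where c: "v = (\<lambda>x. \<Sum>j\<in>J. c j * \<Phi> j x)"
    using assms unfolding basis_of_def by blast
  have Q: "?Q (restrict c J)" using c by simp
  have "\<exists>!c. ?Q c"
  proof (rule ex1I[where P = ?Q and a = "restrict c J"], rule Q)
    fix d assume d: "?Q d"
    \<comment> \<open>Two expansions of \<open>v\<close> differ by an expansion of zero, whose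
      coefficients all vanish.\<close>
    have "(\<lambda>x. \<Sum>j\<in>J. (d j - c j) * \<Phi> j x) = 0"
    proof
      fix x
      have "(\<Sum>j\<in>J. d j * \<Phi> j x) = (\<Sum>j\<in>J. c j * \<Phi> j x)" using c d by metis
      then show "(\<Sum>j\<in>J. (d j - c j) * \<Phi> j x) = 0 x"
        by (simp add: left_diff_distrib sum_subtractf)
    qed
    moreover have "\<forall>e. (\<lambda>x. \<Sum>j\<in>J. e j * \<Phi> j x) = 0 \<longrightarrow> (\<forall>j\<in>J. e j = 0)"
      using assms(1) unfolding basis_of_def by blast
    ultimately have "\<forall>j\<in>J. d j - c j = 0"
      by (elim allE[of _ "\<lambda>j. d j - c j"]) simp
    then show "d = restrict c J"
      using d by (auto intro!: extensionalityI[of _ J])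
  qed
  then have "?Q (coefficients J \<Phi> v)" unfolding coefficients_def by (rule theI')
  then show ?thesis by blast
qed

text \<open>A basis function whose coefficient is cut off has support disjoint from
  \<open>\<omega>\<close>, so it vanishes at \<open>x\<close>; the remaining terms carry equal
  coefficients.\<close>

lemma eq_on_patch_if_patch_coefficients_eq:
  assumes "basis_of V J \<Phi>" "v \<in> V" "v' \<in> V" "x \<in> \<omega>"
    and "patch_coefficients J \<Phi> \<omega> v = patch_coefficients J \<Phi> \<omega> v'"
  shows "v x = v' x"
proof -
  have "coefficients J \<Phi> v j * \<Phi> j x = coefficients J \<Phi> v' j * \<Phi> j x" if "j \<in> J" for j
  proof (cases "supp (\<Phi> j) \<inter> \<omega> = {}")
    case True
    then have "\<Phi> j x = 0"
      using assms(4) closure_subset[of "{x. \<Phi> j x \<noteq> 0}"] unfolding supp_def by blast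
    then show ?thesis by simp
  next
    case False
    then have "j \<in> {j\<in>J. supp (\<Phi> j) \<inter> \<omega> \<noteq> {}}" using that by simp
    then show ?thesis
      using assms(5) unfolding patch_coefficients_def by (metis (no_types, lifting) restrict_apply')
  qed
  then have "(\<Sum>j\<in>J. coefficients J \<Phi> v j * \<Phi> j x) = (\<Sum>j\<in>J. coefficients J \<Phi> v' j * \<Phi> j x)"
    by (rule sum.cong[OF refl])
  then show ?thesis
    using coefficients_expansion[OF assms(1,2)] coefficients_expansion[OF assms(1,3)] by metis
qed

text \<open>Well-definedness of the description in \<open>local_correction\<close>. Coarse functions
  with equal patch coefficients agree on the patch, and the restricted form sees only values there,
  so they share their solutions.\<close>

lemma local_correction_in_patch_space:
  assumes V: "fsubspace V" "VH \<subseteq> V" "Vf \<subseteq> V" and basis: "basis_of VH J \<Phi>"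
    and form: "patch_restriction_form V \<omega> A (Aloc \<omega>)"
    and ex1: "\<exists>!v. solves_correction (patch_space Vf \<omega>) (Aloc \<omega>) (Lloc \<omega>) vH v"
    and vH: "vH \<in> VH"
  shows "local_correction VH Vf J \<Phi> Aloc Lloc \<omega> (patch_coefficients J \<Phi> \<omega> vH) \<in> patch_space Vf \<omega>"
proof -
  let ?S = "solves_correction (patch_space Vf \<omega>) (Aloc \<omega>) (Lloc \<omega>)"
  let ?Q = "\<lambda>v. \<forall>uH\<in>VH. patch_coefficients J \<Phi> \<omega> uH = patch_coefficients J \<Phi> \<omega> vH \<longrightarrow> ?S uH v"
  have indep: "?S uH v"
    if "uH \<in> VH" "patch_coefficients J \<Phi> \<omega> uH = patch_coefficients J \<Phi> \<omega> vH" "?S vH v" for uH v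
  proof -
    have v: "v \<in> patch_space Vf \<omega>" "v \<in> V"
      using that(3) V(3) unfolding solves_correction_def patch_space_def by auto
    have eq: "\<forall>x\<in>\<omega>. (uH + v) x = (vH + v) x"
      using eq_on_patch_if_patch_coefficients_eq[OF basis that(1) vH _ that(2)] by simp
    have mem: "uH + v \<in> V" "vH + v \<in> V"
      using that(1) vH v V by (auto intro: fsubspace_add)
    have "Aloc \<omega> (uH + v) w = Aloc \<omega> (vH + v) w" if "w \<in> patch_space Vf \<omega>" for w
    proof -
      have "w \<in> V" using that V(3) unfolding patch_space_def by auto
      then show ?thesis using form mem eq unfolding patch_restriction_form_def by blast
    qed
    then show ?thesis using that(3) unfolding solves_correction_def by simp
  qed
  \<comment> \<open>Existence comes from \<open>indep\<close>; uniqueness comes from the instance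
    \<open>uH = vH\<close>.\<close>
  have "\<exists>!v. ?Q v"
    using ex1 indep vH by metis
  then have "?Q (local_correction VH Vf J \<Phi> Aloc Lloc \<omega> (patch_coefficients J \<Phi> \<omega> vH))"
    unfolding local_correction_def by (rule theI')
  then show ?thesis using vH unfolding solves_correction_def by blast
qed

section \<open>Localized and ideal reconstructions\<close>

text \<open>Each local correction lies in its patch space, so the cut-off sum lies in the domain
  \<open>X\<close> of \<open>Ih\<close> and \<open>z\<close> lies in \<open>V\<close>. As
  \<open>PH\<close> is a projection, it annihilates \<open>z - PH z\<close> and only the coarse part
  \<open>vH\<close> survives.\<close>

lemma localized_reconstruction_coarse_part:
  fixes \<phi> :: "'i \<Rightarrow> 'a::euclidean_space \<Rightarrow> real" and TH :: "'a set set" and l :: nat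
  defines "\<omega>0 \<equiv> \<lambda>i. interior (supp (\<phi> i))"
  defines "\<omega> \<equiv> \<lambda>i. patch TH l (\<omega>0 i)"
  assumes V: "fsubspace V" "VH \<subseteq> V" "fsubspace X" and PH: "linear_projection_on V VH PH"
    and Ih: "Ih ` X \<subseteq> V" and basis: "basis_of VH J \<Phi>"
    and form: "\<forall>i\<in>I. patch_restriction_form V (\<omega> i) A (Aloc (\<omega> i))"
    and ex1: "\<forall>i\<in>I. \<forall>vH\<in>VH. \<exists>!v. solves_correction
      (patch_space (kernel_in V PH) (\<omega> i)) (Aloc (\<omega> i)) (Lloc (\<omega> i)) vH v"
    and X: "\<forall>i\<in>I. \<forall>v\<in>patch_space (kernel_in V PH) (\<omega> i).
      \<phi> i * zero_extension (\<omega>0 i) (restriction (\<omega>0 i) v) \<in> X"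
    and vH: "vH \<in> VH"
  shows "localized_reconstruction TH VH (kernel_in V PH) PH Ih J \<Phi> I \<phi> Aloc Lloc l vH \<in> V" (is "?M \<in> V")
    and "PH (localized_reconstruction TH VH (kernel_in V PH) PH Ih J \<Phi> I \<phi> Aloc Lloc l vH) = vH"
proof -
  let ?v = "\<lambda>i. local_correction VH (kernel_in V PH) J \<Phi> Aloc Lloc (\<omega> i)
    (patch_coefficients J \<Phi> (\<omega> i) vH)"
  define z where
    "z = Ih (\<Sum>i\<in>I. \<phi> i * zero_extension (\<omega>0 i) (restriction (\<omega>0 i) (?v i)))"
  have "?v i \<in> patch_space (kernel_in V PH) (\<omega> i)" if "i \<in> I" for i
    using V(1,2) basis form ex1 vH that
    by (intro local_correction_in_patch_space[where V = V and A = A]) (auto simp: kernel_in_def)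
  then have "(\<Sum>i\<in>I. \<phi> i * zero_extension (\<omega>0 i) (restriction (\<omega>0 i) (?v i))) \<in> X"
    using X by (intro fsubspace_sum[OF V(3)]) blast
  then have z: "z \<in> V" using Ih unfolding z_def by blast
  have map: "linear_map_on V VH PH" and id: "\<forall>w\<in>VH. PH w = w"
    using PH unfolding linear_projection_on_def by auto
  have PHz: "PH z \<in> VH" "PH z \<in> V"
    using map z V(2) unfolding linear_map_on_def by auto
  have M: "?M = vH + (z - PH z)"
    unfolding localized_reconstruction_def Let_def z_def \<omega>_def \<omega>0_def by simp
  have d: "z - PH z \<in> V" using V(1) z PHz(2) by (rule fsubspace_diff)
  show "?M \<in> V" unfolding M using V vH d by (auto intro: fsubspace_add)
  have "PH (vH + (z - PH z)) = PH vH + PH (z - PH z)"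
    using map vH V(2) d unfolding linear_map_on_def by blast
  also have "PH (z - PH z) = PH z - PH (PH z)"
    using V(1) map z PHz(2) by (rule linear_map_on_diff)
  also have "PH vH + (PH z - PH (PH z)) = vH" using id vH PHz(1) by (simp add: fun_eq_iff)
  finally show "PH ?M = vH" unfolding M .
qed

text \<open>The fine part \<open>u - PH u\<close> lies in the kernel of \<open>PH\<close> and solves
  the correction problem of \<open>PH u\<close>, hence it is the unique correction.\<close>

lemma ideal_reconstruction_exact:
  assumes V: "fsubspace V" "VH \<subseteq> V" and PH: "linear_projection_on V VH PH"
    and ex1: "\<exists>!v. solves_correction (kernel_in V PH) A L (PH u) v"
    and u: "u \<in> V" "\<forall>v\<in>V. A u v = L v"
  shows "ideal_reconstruction (kernel_in V PH) A L (PH u) = u"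
proof -
  have map: "linear_map_on V VH PH" and id: "\<forall>w\<in>VH. PH w = w"
    using PH unfolding linear_projection_on_def by auto
  have PHu: "PH u \<in> VH" "PH u \<in> V"
    using map u(1) V(2) unfolding linear_map_on_def by auto
  have "PH (u - PH u) = 0"
    using linear_map_on_diff[OF V(1) map u(1) PHu(2)] id PHu(1) by simp
  then have "solves_correction (kernel_in V PH) A L (PH u) (u - PH u)"
    using u fsubspace_diff[OF V(1) u(1) PHu(2)] unfolding solves_correction_def kernel_in_def by simp
  then have "(THE v. solves_correction (kernel_in V PH) A L (PH u) v) = u - PH u"
    using ex1 by (intro the1_equality)
  then show ?thesis unfolding ideal_reconstruction_def by simp
qed

section \<open>Calculus along a segment\<close>

text \<open>A chain rule: \<open>D\<close> is linear in the increment, and the bound on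
  \<open>F\<close> turns the Frechet remainder of \<open>M\<close> into a remainder of a real
  function. Scalar calculus then suffices for the Taylor estimate.\<close>

lemma frechet_derivative_along_line:
  assumes D: "has_frechet_derivative V W nrm M D (u + fscale s \<xi>)"
    and V: "fsubspace V" "u \<in> V" "\<xi> \<in> V" and W: "fsubspace W" "M ` V \<subseteq> W"
    and F: "linear_functional_on W F" "\<And>w. w \<in> W \<Longrightarrow> \<bar>F w\<bar> \<le> C * nrm w" "0 \<le> C"
    and nrm: "\<And>c. nrm (fscale c \<xi>) = \<bar>c\<bar> * nrm \<xi>" "0 \<le> nrm \<xi>"
  shows "((\<lambda>s. F (M (u + fscale s \<xi>))) has_real_derivative F (D \<xi>)) (at s)"
  unfolding has_field_derivative_def has_derivative_at_alt
proof (intro conjI allI impI)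
  show "bounded_linear ((*) (F (D \<xi>)))" by (rule bounded_linear_mult_right)
next
  fix e :: real assume e: "0 < e"
  let ?v = "u + fscale s \<xi>"
  have map: "linear_map_on V W D" using D unfolding has_frechet_derivative_def by blast
  \<comment> \<open>Chosen so that the final bound is \<open>e * \<bar>y - s\<bar>\<close> times
    \<open>C / (C + 1)\<close> and \<open>nrm \<xi> / (nrm \<xi> + 1)\<close>, both at most 1. The
    added ones keep the denominators positive when \<open>C\<close> or \<open>nrm \<xi>\<close> is
    zero.\<close>
  define \<epsilon> where "\<epsilon> = e / ((C + 1) * (nrm \<xi> + 1))"
  have "\<epsilon> > 0" using e F(3) nrm(2) by (simp add: \<epsilon>_def)
  then obtain \<delta> where \<delta>: "\<delta> > 0"
    "\<And>h. h \<in> V \<Longrightarrow> nrm h < \<delta> \<Longrightarrow> nrm (M (?v + h) - M ?v - D h) \<le> \<epsilon> * nrm h"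
    using D unfolding has_frechet_derivative_def by blast
  show "\<exists>d>0. \<forall>y. norm (y - s) < d \<longrightarrow>
    norm (F (M (u + fscale y \<xi>)) - F (M ?v) - F (D \<xi>) * (y - s)) \<le> e * norm (y - s)"
  proof (intro exI[of _ "\<delta> / (nrm \<xi> + 1)"] conjI allI impI)
    show "0 < \<delta> / (nrm \<xi> + 1)" using \<delta>(1) nrm(2) by simp
  next
    fix y assume y: "norm (y - s) < \<delta> / (nrm \<xi> + 1)"
    define h where "h = fscale (y - s) \<xi>"
    have h: "h \<in> V" using V unfolding h_def by (auto intro: fsubspace_scale)
    have line: "u + fscale y \<xi> = ?v + h"
      by (auto simp: h_def fscale_def algebra_simps)
    have v: "?v \<in> V" "?v + h \<in> V" using V h by (auto intro!: fsubspace_add fsubspace_scale)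
    have "nrm h \<le> \<bar>y - s\<bar> * (nrm \<xi> + 1)" unfolding h_def nrm(1) by (intro mult_left_mono) auto
    also have "\<dots> < \<delta>" using y nrm(2) by (simp add: pos_less_divide_eq)
    finally have le: "nrm (M (?v + h) - M ?v - D h) \<le> \<epsilon> * nrm h" using \<delta>(2) h by blast
    have mem: "M (?v + h) \<in> W" "M ?v \<in> W" "D \<xi> \<in> W" "D h \<in> W"
      using W(2) v map h V(3) unfolding linear_map_on_def by auto
    have "D h = fscale (y - s) (D \<xi>)" using map V(3) unfolding h_def linear_map_on_def by blast
    then have "F (D h) = F (D \<xi>) * (y - s)"
      using linear_functional_on_scale[OF F(1) mem(3)] by simp
    then have "F (M (u + fscale y \<xi>)) - F (M ?v) - F (D \<xi>) * (y - s)
      = F (M (?v + h) - M ?v - D h)"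
      unfolding line using linear_functional_on_diff[OF W(1) F(1)] mem fsubspace_diff[OF W(1)] by simp
    also have "\<bar>\<dots>\<bar> \<le> C * (\<epsilon> * nrm h)"
      using F(2)[of "M (?v + h) - M ?v - D h"] mem fsubspace_diff[OF W(1)] mult_left_mono[OF le F(3)]
      by force
    also have "\<dots> = (C / (C + 1)) * (nrm \<xi> / (nrm \<xi> + 1)) * (e * \<bar>y - s\<bar>)"
      unfolding \<epsilon>_def h_def nrm(1) by simp
    also have "\<dots> \<le> 1 * (e * \<bar>y - s\<bar>)"
      using e F(3) nrm(2) by (intro mult_right_mono mult_le_one) auto
    finally show "norm (F (M (u + fscale y \<xi>)) - F (M ?v) - F (D \<xi>) * (y - s)) \<le> e * norm (y - s)"
      by simp
  qed
qed

text \<open>Subtracting \<open>g' 0 * s + B / 2 * s^2\<close> from \<open>g\<close> leaves a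
  function with nonpositive derivative on the unit interval.\<close>

lemma taylor_bound_lipschitz_derivative:
  fixes g g' :: "real \<Rightarrow> real"
  assumes "\<And>s. s \<in> {0..1} \<Longrightarrow> (g has_real_derivative g' s) (at s)"
    and "\<And>s. s \<in> {0..1} \<Longrightarrow> g' s \<le> g' 0 + B * s"
  shows "g 1 - g 0 \<le> g' 0 + B / 2"
proof -
  let ?h = "\<lambda>s. g s - g' 0 * s - B / 2 * s^2"
  have "?h 1 \<le> ?h 0"
  proof (rule DERIV_nonpos_imp_nonincreasing[of 0 1 ?h])
    fix s :: real assume "0 \<le> s" "s \<le> 1"
    then have s: "s \<in> {0..1}" by simp
    have "(?h has_real_derivative g' s - g' 0 - B * s) (at s)"
      by (auto intro!: derivative_eq_intros assms(1)[OF s])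
    then show "\<exists>y. (?h has_real_derivative y) (at s) \<and> y \<le> 0"
      using assms(2)[OF s] by (intro exI conjI) auto
  qed simp
  then show ?thesis by simp
qed

section \<open>The error estimate\<close>

theorem proposition7p2:
  fixes \<Omega> :: "'a::euclidean_space set"
    and TH Th :: "'a set set"
    and \<rho> \<tau> :: real
    and VH Vh Vf X UH Uh :: "('a \<Rightarrow> real) set"
    and a A :: "('a \<Rightarrow> real) \<Rightarrow> ('a \<Rightarrow> real) \<Rightarrow> real"
    and L nrm :: "('a \<Rightarrow> real) \<Rightarrow> real"
    and PH Ih M Ml :: "('a \<Rightarrow> real) \<Rightarrow> 'a \<Rightarrow> real"
    and DMl :: "('a \<Rightarrow> real) \<Rightarrow> ('a \<Rightarrow> real) \<Rightarrow> 'a \<Rightarrow> real"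
    and Aloc :: "'a set \<Rightarrow> ('a \<Rightarrow> real) \<Rightarrow> ('a \<Rightarrow> real) \<Rightarrow> real"
    and Lloc :: "'a set \<Rightarrow> ('a \<Rightarrow> real) \<Rightarrow> real"
    and J :: "'j set" and \<Phi> :: "'j \<Rightarrow> 'a \<Rightarrow> real"
    and I :: "'i set" and \<phi> :: "'i \<Rightarrow> 'a \<Rightarrow> real"
    and \<omega>0 \<omega> :: "'i \<Rightarrow> 'a set"
    and l :: nat
    and uh uH ums :: "'a \<Rightarrow> real"
    and CP CI mA LA LM \<gamma> :: real
    and \<eta> :: ennreal
  defines "VH \<equiv> p1_space \<Omega> TH"
    and "Vh \<equiv> p1_space \<Omega> Th"
    and "nrm \<equiv> energy_norm a"
    and "Vf \<equiv> kernel_in Vh PH"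
    and "\<omega>0 \<equiv> \<lambda>i. interior (supp (\<phi> i))"
    and "\<omega> \<equiv> \<lambda>i. patch TH l (\<omega>0 i)"
    and "M \<equiv> ideal_reconstruction Vf A L"
    and "Ml \<equiv> localized_reconstruction TH VH Vf PH Ih J \<Phi> I \<phi> Aloc Lloc l"
    and "ums \<equiv> Ml uH"
    and "\<gamma> \<equiv> 1/2 * LA * LM * CP^2"
    and "\<eta> \<equiv> localization_error nrm UH M Ml"
  \<comment> \<open>domain, meshes, energy norm\<close>
  assumes "DIM('a) = 2 \<or> DIM('a) = 3"
    and "polyhedral_domain \<Omega>"
    and "mesh_of \<Omega> TH" and "mesh_of \<Omega> Th" and "mesh_refinement Th TH"
    and "shape_regular \<rho> TH" and "shape_regular \<rho> Th"
    and "quasi_uniform \<tau> TH" and "quasi_uniform \<tau> Th"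
    and "fsubspace X" and "Vh \<subseteq> X" and "energy_form X Vh a"
  \<comment> \<open>fine problem\<close>
    and "\<forall>v\<in>Vh. linear_functional_on Vh (A v)"
    and "linear_functional_on Vh L"
    and "\<exists>!u. u \<in> Vh \<and> (\<forall>v\<in>Vh. A u v = L v)"
    and "uh \<in> Vh" and "\<forall>v\<in>Vh. A uh v = L v"
  \<comment> \<open>coarse projection and ideal corrections\<close>
    and "linear_projection_on Vh VH PH"
    and "\<forall>v\<in>Vh. nrm (PH v) \<le> CP * nrm v"
    and "\<forall>vH\<in>VH. \<exists>!v. solves_correction Vf A L vH v"
  \<comment> \<open>localized corrections and fine-grid interpolation\<close>
    and "partition_of_unity_on \<Omega> TH I \<phi>"
    and "basis_of VH J \<Phi>"
    and "\<forall>i\<in>I. patch_restriction_form Vh (\<omega> i) A (Aloc (\<omega> i))"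
    and "\<forall>i\<in>I. patch_restriction_functional Vh (\<omega> i) L (Lloc (\<omega> i))"
    and "\<forall>i\<in>I. \<forall>vH\<in>VH.
           \<exists>!v. solves_correction (patch_space Vf (\<omega> i)) (Aloc (\<omega> i)) (Lloc (\<omega> i)) vH v"
    and "\<forall>i\<in>I. \<forall>v\<in>patch_space Vf (\<omega> i).
           \<phi> i * zero_extension (\<omega>0 i) (restriction (\<omega>0 i) v) \<in> X"
    and "linear_projection_on X Vh Ih"
    and "\<forall>z\<in>X. nrm (Ih z) \<le> CI * nrm z"
  \<comment> \<open>admissible sets and derivative of the localized reconstruction\<close>
    and "Uh \<subseteq> Vh" and "UH \<subseteq> VH"
    and "\<forall>v\<in>UH. has_frechet_derivative VH Vh nrm Ml (DMl v) v"
    and "uH \<in> VH"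
    and "\<forall>s\<in>{0..1}. uH + fscale s (PH uh - uH) \<in> UH"
    and "uh \<in> Uh" and "ums \<in> Uh" and "Ml (PH uh) \<in> Uh"
  \<comment> \<open>hypotheses of the proposition\<close>
    and "\<forall>\<xi>\<in>VH. residual A L ums (DMl uH \<xi>) = 0"
    and "mA > 0" and "LA > 0"
    and "\<forall>v\<in>Uh. \<forall>w\<in>Uh. mA * (nrm (v - w))^2 \<le> A v (v - w) - A w (v - w)"
    and "\<forall>v\<in>Uh. \<forall>w\<in>Uh. dual_norm Vh nrm (\<lambda>z. A v z - A w z) \<le> ennreal (LA * nrm (v - w))"
    and "\<forall>v\<in>UH. \<forall>w\<in>UH. \<forall>\<xi>\<in>VH. nrm (DMl v \<xi> - DMl w \<xi>) \<le> LM * nrm (v - w) * nrm \<xi>"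
    and "\<gamma> * nrm (uh - ums) \<le> 1/2 * mA"
  shows "ennreal (nrm (uh - ums)) \<le> ennreal (2 * LA / mA) * \<eta>"
proof -
  have refine: "mesh_refinement Th TH" by fact
  have sX: "fsubspace X" and VX: "Vh \<subseteq> X" and ef: "energy_form X Vh a" by fact+
  have PH: "linear_projection_on Vh VH PH" by fact
  have uh: "uh \<in> Vh" "\<forall>v\<in>Vh. A uh v = L v" by fact+
  have Ahlin: "\<forall>v\<in>Vh. linear_functional_on Vh (A v)" by fact
  have Llin: "linear_functional_on Vh L" by fact
  have uH: "uH \<in> VH" by fact
  have UH: "UH \<subseteq> VH" by fact
  have seg: "\<forall>s\<in>{0..1}. uH + fscale s (PH uh - uH) \<in> UH" by fact
  have pos: "mA > 0" "LA > 0" by fact+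
  have DMl: "\<forall>v\<in>UH. has_frechet_derivative VH Vh nrm Ml (DMl v) v" by fact
  have uhU: "uh \<in> Uh" and umsU: "ums \<in> Uh" by fact+
  have monotone: "\<forall>v\<in>Uh. \<forall>w\<in>Uh. mA * (nrm (v - w))^2 \<le> A v (v - w) - A w (v - w)" by fact
  have lipschitz: "\<forall>v\<in>Uh. \<forall>w\<in>Uh. dual_norm Vh nrm (\<lambda>z. A v z - A w z) \<le> ennreal (LA * nrm (v - w))"
    by fact
  have DMl_lipschitz:
    "\<forall>v\<in>UH. \<forall>w\<in>UH. \<forall>\<xi>\<in>VH. nrm (DMl v \<xi> - DMl w \<xi>) \<le> LM * nrm (v - w) * nrm \<xi>" by fact
  have sV: "fsubspace Vh" and sVH: "fsubspace VH"
    unfolding VH_def Vh_def by (rule fsubspace_p1_space)+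
  have VHV: "VH \<subseteq> Vh"
    unfolding VH_def Vh_def using refine by (rule p1_space_mono_refinement)
  have map: "linear_map_on Vh VH PH" and PHid: "\<forall>w\<in>VH. PH w = w"
    using PH unfolding linear_projection_on_def by auto
  have PHuh: "PH uh \<in> VH" using map uh(1) unfolding linear_map_on_def by auto
  have Ih: "Ih ` X \<subseteq> Vh"
    using \<open>linear_projection_on X Vh Ih\<close> unfolding linear_projection_on_def linear_map_on_def by auto

  have Ml: "Ml v \<in> Vh" "PH (Ml v) = v" if "v \<in> VH" for v
    using localized_reconstruction_coarse_part[OF sV VHV sX PH Ih \<open>basis_of VH J \<Phi>\<close>
        \<open>\<forall>i\<in>I. patch_restriction_form Vh (\<omega> i) A (Aloc (\<omega> i))\<close>[unfolded \<omega>_def \<omega>0_def]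
        \<open>\<forall>i\<in>I. \<forall>vH\<in>VH. \<exists>!v. solves_correction (patch_space Vf (\<omega> i)) (Aloc (\<omega> i)) (Lloc (\<omega> i)) vH v\<close>
          [unfolded \<omega>_def \<omega>0_def Vf_def]
        \<open>\<forall>i\<in>I. \<forall>v\<in>patch_space Vf (\<omega> i).
           \<phi> i * zero_extension (\<omega>0 i) (restriction (\<omega>0 i) v) \<in> X\<close>[unfolded \<omega>_def \<omega>0_def Vf_def] that]
    unfolding Ml_def Vf_def by auto
  have "\<exists>!v. solves_correction Vf A L (PH uh) v"
    using \<open>\<forall>vH\<in>VH. \<exists>!v. solves_correction Vf A L vH v\<close> PHuh by blast
  then have M: "M (PH uh) = uh"
    unfolding M_def Vf_def by (rule ideal_reconstruction_exact[OF sV VHV PH]) (fact uh)+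

  have nrm_nonneg: "0 \<le> nrm v" if "v \<in> Vh" for v
    unfolding nrm_def using ef that VX by (intro energy_norm_nonneg) (auto simp: energy_form_def)
  have nrm_pos: "0 < nrm v" if "v \<in> Vh" "v \<noteq> 0" for v
    using ef that unfolding nrm_def energy_norm_def energy_form_def by simp
  have nrm_scale: "nrm (fscale c v) = \<bar>c\<bar> * nrm v" if "v \<in> Vh" for c v
    unfolding nrm_def using energy_norm_fscale[OF sX ef] that VX by blast

  have ums: "ums \<in> Vh" unfolding ums_def using Ml uH by blast
  define e where "e = uh - ums"
  define \<xi> where "\<xi> = PH uh - uH"
  \<comment> \<open>On \<open>Vh\<close> this is the residual of \<open>ums\<close>, because
    \<open>A uh\<close> equals \<open>L\<close> there. This form makes the Lipschitz bound on
    \<open>A\<close> directly applicable.\<close>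
  define F where "F = (\<lambda>w. A uh w - A ums w)"
  have e: "e \<in> Vh" unfolding e_def using sV uh(1) ums by (rule fsubspace_diff)
  have \<xi>: "\<xi> \<in> VH" unfolding \<xi>_def using sVH PHuh uH by (rule fsubspace_diff)
  \<comment> \<open>The coarse part of \<open>ums\<close> is \<open>uH\<close>, so stability of
    \<open>PH\<close> bounds the coarse error by the full error.\<close>
  have "\<xi> = PH e"
    unfolding \<xi>_def e_def linear_map_on_diff[OF sV map uh(1) ums] using Ml(2)[OF uH] ums_def by simp
  then have \<xi>_le: "nrm \<xi> \<le> CP * nrm e"
    using \<open>\<forall>v\<in>Vh. nrm (PH v) \<le> CP * nrm v\<close> e by simp
  have C: "0 \<le> LA * nrm e" using pos nrm_nonneg[OF e] by simp
  have Flin: "linear_functional_on Vh F"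
    using Ahlin uh(1) ums unfolding F_def linear_functional_on_def by (simp add: algebra_simps)
  have F_le: "\<bar>F w\<bar> \<le> LA * nrm e * nrm w" if "w \<in> Vh" for w
  proof (rule abs_le_of_dual_norm_le[OF sV Flin nrm_pos _ _ C that])
    show "0 \<le> nrm 0" using sV by (intro nrm_nonneg) (simp add: fsubspace_def)
    show "dual_norm Vh nrm F \<le> ennreal (LA * nrm e)"
      unfolding F_def e_def using bspec[OF bspec[OF lipschitz uhU] umsU] .
  qed

  \<comment> \<open>\<open>g\<close> runs from \<open>F ums\<close> at 0 to
    \<open>F (Ml (PH uh))\<close> at 1, and \<open>g'\<close> is its derivative.\<close>
  define g where "g = (\<lambda>s. F (Ml (uH + fscale s \<xi>)))"
  define g' where "g' = (\<lambda>s. F (DMl (uH + fscale s \<xi>) \<xi>))"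
  have seg': "uH + fscale s \<xi> \<in> UH" if "s \<in> {0..1}" for s using seg that unfolding \<xi>_def by blast
  have uH_0: "uH + fscale 0 \<xi> = uH" and uH_1: "uH + fscale 1 \<xi> = PH uh"
    by (simp_all add: \<xi>_def fscale_def fun_eq_iff)
  have \<xi>V: "\<xi> \<in> Vh" using \<xi> VHV by blast
  have DV: "DMl v \<xi> \<in> Vh" if "v \<in> UH" for v
    using DMl that \<xi> unfolding has_frechet_derivative_def linear_map_on_def by blast
  have uHU: "uH \<in> UH" using seg'[of 0] uH_0 by simp
  \<comment> \<open>The tangent-space coarse equation tested with \<open>\<xi>\<close>.\<close>
  have g0: "g' 0 = 0"
  proof -
    have "residual A L ums (DMl uH \<xi>) = 0"
      using \<open>\<forall>\<xi>\<in>VH. residual A L ums (DMl uH \<xi>) = 0\<close> \<xi> by blast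
    then show ?thesis using uh(2) DV[OF uHU] unfolding g'_def uH_0 F_def residual_def by simp
  qed
  \<comment> \<open>In the constant, \<open>LA * nrm e\<close> bounds the functional
    \<open>F\<close>; one factor \<open>nrm \<xi>\<close> is the direction of the derivative, the
    other comes from the distance \<open>s * nrm \<xi>\<close> between the base points.\<close>
  have "g 1 - g 0 \<le> g' 0 + (LA * nrm e * (LM * (nrm \<xi>)^2)) / 2"
  proof (rule taylor_bound_lipschitz_derivative)
    fix s :: real assume s: "s \<in> {0..1}"
    show "(g has_real_derivative g' s) (at s)"
      unfolding g_def g'_def
      using frechet_derivative_along_line[OF bspec[OF DMl seg'[OF s]] sVH uH \<xi> sV _ Flin F_le C
          nrm_scale[OF \<xi>V] nrm_nonneg[OF \<xi>V]] Ml(1) by blast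
    have "g' s - g' 0 = F (DMl (uH + fscale s \<xi>) \<xi> - DMl uH \<xi>)"
      unfolding g'_def uH_0
      using linear_functional_on_diff[OF sV Flin DV[OF seg'[OF s]] DV[OF uHU]] by simp
    also have "\<dots> \<le> LA * nrm e * nrm (DMl (uH + fscale s \<xi>) \<xi> - DMl uH \<xi>)"
      using F_le[OF fsubspace_diff[OF sV DV[OF seg'[OF s]] DV[OF uHU]]] by simp
    also have "\<dots> \<le> LA * nrm e * (LM * nrm (uH + fscale s \<xi> - uH) * nrm \<xi>)"
      using bspec[OF bspec[OF bspec[OF DMl_lipschitz seg'[OF s]] uHU] \<xi>] C by (rule mult_left_mono)
    also have "nrm (uH + fscale s \<xi> - uH) = s * nrm \<xi>"
      using nrm_scale[OF \<xi>V, of s] s by simp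
    finally show "g' s \<le> g' 0 + LA * nrm e * (LM * (nrm \<xi>)^2) * s"
      by (simp add: power2_eq_square algebra_simps)
  qed
  then have rem: "F (Ml (PH uh)) - F ums \<le> (LA * nrm e * (LM * (nrm \<xi>)^2)) / 2"
    using g0 unfolding g_def uH_0 uH_1 ums_def by simp
  also have "\<dots> \<le> 1/2 * mA * (nrm e)^2"
  \<comment> \<open>The sign of \<open>LM\<close> is not prescribed. Enlarging
    \<open>nrm \<xi>\<close> to \<open>CP * nrm e\<close> is monotone only for nonnegative
    \<open>LM\<close>; otherwise the remainder bound is itself nonpositive.\<close>
  proof (cases "LM \<ge> 0")
    case True
    have "(nrm \<xi>)^2 \<le> (CP * nrm e)^2" using \<xi>_le nrm_nonneg[OF \<xi>V] by (rule power_mono)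
    then have "LA * nrm e * (LM * (nrm \<xi>)^2) / 2 \<le> LA * nrm e * (LM * (CP * nrm e)^2) / 2"
      using True C by (intro divide_right_mono mult_left_mono) auto
    \<comment> \<open>The Taylor factor 1/2 is the one in \<open>\<gamma>\<close>, so the smallness
      condition applies to \<open>\<gamma> * nrm e\<close>.\<close>
    also have "\<dots> = (\<gamma> * nrm e) * (nrm e)^2"
      unfolding \<gamma>_def by (simp add: power_mult_distrib)
    also have "\<dots> \<le> 1/2 * mA * (nrm e)^2"
      using \<open>\<gamma> * nrm (uh - ums) \<le> 1/2 * mA\<close> unfolding e_def by (intro mult_right_mono) auto
    finally show ?thesis .
  next
    case False
    have "LA * nrm e * (LM * (nrm \<xi>)^2) / 2 \<le> 0"
      using False C by (simp add: mult_nonneg_nonpos mult_nonpos_nonneg)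
    also have "0 \<le> 1/2 * mA * (nrm e)^2" using pos by simp
    finally show ?thesis .
  qed
  finally have second: "F (Ml (PH uh)) - F ums \<le> 1/2 * mA * (nrm e)^2" .

  define d where "d = nrm (uh - Ml (PH uh))"
  have dV: "uh - Ml (PH uh) \<in> Vh" using sV uh(1) Ml(1)[OF PHuh] by (rule fsubspace_diff)
  have first: "F (uh - Ml (PH uh)) \<le> LA * nrm e * d"
    using F_le[OF dV] unfolding d_def by simp
  have "mA * (nrm e)^2 \<le> F e"
    unfolding F_def e_def using bspec[OF bspec[OF monotone uhU] umsU] .
  also have "F e = F (uh - Ml (PH uh)) + (F (Ml (PH uh)) - F ums)"
    unfolding e_def using linear_functional_on_diff[OF sV Flin] uh(1) ums Ml(1)[OF PHuh] by simp
  \<comment> \<open>The second part takes up half of the monotonicity term, which accounts for the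
    factor 2 in the final constant.\<close>
  finally have "mA * (nrm e)^2 / 2 \<le> LA * nrm e * d" using first second by simp
  then have "nrm e * (mA * nrm e) \<le> nrm e * (2 * LA * d)"
    by (simp add: power2_eq_square algebra_simps)
  moreover have d: "0 \<le> d" unfolding d_def using dV by (rule nrm_nonneg)
  \<comment> \<open>One factor \<open>nrm e\<close> cancels; if it is zero, the claim reduces to
    \<open>0 \<le> d\<close>.\<close>
  ultimately have "mA * nrm e \<le> 2 * LA * d"
    using nrm_nonneg[OF e] pos by (cases "nrm e = 0") auto
  then have "nrm e \<le> 2 * LA / mA * d"
    using pos by (simp add: field_simps)
  then have "ennreal (nrm (uh - ums)) \<le> ennreal (2 * LA / mA) * ennreal d"
    using pos d unfolding e_def by (simp add: ennreal_leI flip: ennreal_mult)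
  \<comment> \<open>\<open>PH uh\<close> is the endpoint \<open>s = 1\<close> of the segment and so
    belongs to \<open>UH\<close>; since \<open>M (PH uh) = uh\<close>, \<open>d\<close> is one of
    the terms of the supremum.\<close>
  also have "ennreal d \<le> \<eta>"
    unfolding \<eta>_def localization_error_def d_def
    using seg'[of 1] unfolding uH_1 by (intro SUP_upper2[of "PH uh"]) (simp_all add: M)
  finally show ?thesis by (simp add: mult_left_mono)
qed

end
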